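(* Let $a<b$ be real numbers, $\alpha\in[0,1)$, $\beta>0$, $p>0$, $y_0\in\mathbb{R}$, and let $\omega\in C^{1}([a,b])$ with $\omega>0$ on $[a,b]$. Let $f\in C([a,b]\times\mathbb{R},\mathbb{R})$ be such that $f(a,y(a))=0$ for the initial value $y(a)=y_0$, and let $y$ and $z$ be two solutions of the initial value problem $${}^{pC}D_{a,t,\omega}^{\alpha,\beta,p}y(t)=f(t,y(t)),\quad t\in[a,b],\qquad y(a)=y_0 .$$ Assume that $f$ is Lipschitz in its second variable, that is, there exists a constant $L>0$ such that $$|f(t,y)-f(t,z)|\le L|y-z|\quad\text{for all } y,z\in\mathbb{R}\text{ and } t\in[a,b].$$ If in addition $L<\dfrac{1}{\phi(\alpha)}$, then $y=z$.
   Context: Let $N$ be a positive normalization function on $[0,1)$ with $N(0)=1$ and $\lim_{\alpha\to1^-}N(\alpha)=1$; put $\phi(\alpha)=\frac{1-\alpha}{N(\alpha)}$ and $\mu_\alpha=\frac{\alpha}{1-\alpha}$. The power Mittag--Leffler function is ${}^{p}E_{k,l}(s)=\sum_{n=0}^{\infty}\frac{(s\ln p)^n}{\Gamma(kn+l)}$ for $s\in\mathbb{C}$, where $k,l,p>0$. The power fractional derivative (Caputo sense) of order $\alpha$ of $g\in H^1(a,b)$ (Sobolev space of order one) with respect to the weight $\omega$ is $${}^{pC}D_{a,t,\omega}^{\alpha,\beta,p}g(t)=\frac{1}{\phi(\alpha)}\frac{1}{\omega(t)}\int_a^t {}^{p}E_{\beta,1}\left(-\mu_\alpha(t-s)^\beta\right)(\omega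 g)'(s)\,\mathrm{d}s .$$ *)

theory Defs
  imports "HOL-Analysis.Analysis"
begin

definition power_phi :: "(real \<Rightarrow> real) \<Rightarrow> real \<Rightarrow> real" where
  "power_phi N \<alpha> = (1 - \<alpha>) / N \<alpha>"

definition power_mu :: "real \<Rightarrow> real" where
  "power_mu \<alpha> = \<alpha> / (1 - \<alpha>)"

text \<open>The series is polymorphic in its argument: at type complex it is the power
  Mittag-Leffler function, at type real its restriction to the real line.\<close>

definition power_mittag_leffler ::
    "real \<Rightarrow> real \<Rightarrow> real \<Rightarrow> 'a \<Rightarrow> 'a::{real_normed_field, banach}" where
  "power_mittag_leffler p k l s =
     (\<Sum>n. (s * of_real (ln p)) ^ n / of_real (Gamma (k * real n + l)))"

text \<open>The library predicate \<open>C1_differentiable_on\<close> demands two-sided derivatives,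
  also at the end points of a compact interval; here they are one-sided.\<close>

definition C1_closed_interval :: "real \<Rightarrow> real \<Rightarrow> (real \<Rightarrow> real) \<Rightarrow> bool" where
  "C1_closed_interval a b w \<longleftrightarrow>
     (\<exists>w'. continuous_on {a..b} w' \<and>
           (\<forall>t\<in>{a..b}. (w has_real_derivative w' t) (at t within {a..b})))"

definition C1_test_function :: "real \<Rightarrow> real \<Rightarrow> (real \<Rightarrow> real) \<Rightarrow> bool" where
  "C1_test_function a b \<psi> \<longleftrightarrow>
     \<psi> C1_differentiable_on UNIV \<and> closure {x. \<psi> x \<noteq> 0} \<subseteq> {a<..<b}"

definition locally_integrable :: "real \<Rightarrow> real \<Rightarrow> (real \<Rightarrow> real) \<Rightarrow> bool" where
  "locally_integrable a b u \<longleftrightarrow>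
     (\<forall>c d. {c..d} \<subseteq> {a<..<b} \<longrightarrow> set_integrable lebesgue {c..d} u)"

text \<open>Weak derivatives on the open interval from \<open>a\<close> to \<open>b\<close>, tested against compactly
  supported C1 functions (by mollification this is the same as testing against
  compactly supported smooth functions).\<close>

definition has_weak_deriv :: "real \<Rightarrow> real \<Rightarrow> (real \<Rightarrow> real) \<Rightarrow> (real \<Rightarrow> real) \<Rightarrow> bool" where
  "has_weak_deriv a b u h \<longleftrightarrow>
     locally_integrable a b u \<and> locally_integrable a b h \<and>
     (\<forall>\<psi>. C1_test_function a b \<psi> \<longrightarrow>
        (LINT x:{a<..<b}|lebesgue. u x * deriv \<psi> x) =
        - (LINT x:{a<..<b}|lebesgue. h x * \<psi> x))"

text \<open>A weak derivative is determined only up to a null set, which does not affect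
  integrals; an arbitrary representative is chosen.\<close>

definition weak_deriv :: "real \<Rightarrow> real \<Rightarrow> (real \<Rightarrow> real) \<Rightarrow> real \<Rightarrow> real" where
  "weak_deriv a b u = (SOME h. has_weak_deriv a b u h)"

definition L2_interval :: "real \<Rightarrow> real \<Rightarrow> (real \<Rightarrow> real) \<Rightarrow> bool" where
  "L2_interval a b u \<longleftrightarrow>
     set_borel_measurable lebesgue {a<..<b} u \<and>
     set_integrable lebesgue {a<..<b} (\<lambda>x. (u x)\<^sup>2)"

definition sobolev_H1 :: "real \<Rightarrow> real \<Rightarrow> (real \<Rightarrow> real) set" where
  "sobolev_H1 a b =
     {u. L2_interval a b u \<and> (\<exists>h. L2_interval a b h \<and> has_weak_deriv a b u h)}"

definition power_caputo_deriv ::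
    "(real \<Rightarrow> real) \<Rightarrow> real \<Rightarrow> real \<Rightarrow> (real \<Rightarrow> real) \<Rightarrow> real \<Rightarrow> real \<Rightarrow> real \<Rightarrow>
     (real \<Rightarrow> real) \<Rightarrow> real \<Rightarrow> real" where
  "power_caputo_deriv N a b \<omega> \<alpha> \<beta> p g t =
     1 / power_phi N \<alpha> * (1 / \<omega> t) *
     (LINT s:{a..t}|lebesgue.
        power_mittag_leffler p \<beta> 1 (- power_mu \<alpha> * (t - s) powr \<beta>) *
        weak_deriv a b (\<lambda>r. \<omega> r * g r) s)"

text \<open>An element of the Sobolev space is an almost-everywhere class; the values \<open>y t\<close> in
  the equation and the initial condition are those of its continuous representative
  on the closed interval.\<close>

definition power_ivp_solution ::
    "(real \<Rightarrow> real) \<Rightarrow> real \<Rightarrow> real \<Rightarrow> (real \<Rightarrow> real) \<Rightarrow> real \<Rightarrow> real \<Rightarrow> real \<Rightarrow>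
     (real \<Rightarrow> real \<Rightarrow> real) \<Rightarrow> real \<Rightarrow> (real \<Rightarrow> real) \<Rightarrow> bool" where
  "power_ivp_solution N a b \<omega> \<alpha> \<beta> p f y0 y \<longleftrightarrow>
     y \<in> sobolev_H1 a b \<and> continuous_on {a..b} y \<and>
     (\<forall>t\<in>{a..b}. power_caputo_deriv N a b \<omega> \<alpha> \<beta> p y t = f t (y t)) \<and>
     y a = y0"

end

theory Submission
  imports Defs
begin

text \<open>Put \<open>d = \<omega> (y - z)\<close> and let \<open>h\<close> be its weak derivative. Subtracting the two equations and using
  the Lipschitz condition gives, with \<open>\<phi> = power_phi N \<alpha>\<close> and the kernel \<open>K r\<close>, which is the
  power Mittag-Leffler function at \<open>- \<mu> r\<^sup>\<beta>\<close>,

  \<open>\<bar>\<integral> K (t - s) h s ds\<bar> \<le> \<phi> L \<bar>d t\<bar>\<close>, the integral running from \<open>a\<close> to \<open>t\<close>.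

  Since \<open>K 0 = 1\<close>, the left-hand side is \<open>\<bar>d t\<bar>\<close> to leading order, and \<open>\<phi> L < 1\<close>: the inequality leaves
  room for a small error only if \<open>d\<close> vanishes.

  To make this precise, \<open>K\<close> is written as a difference of two nondecreasing continuous functions
  (\<open>mittag_leffler_kernel\<close>), by separating the positive from the negative coefficients of the
  Mittag-Leffler series, which converges everywhere because the Gamma function outgrows every
  exponential. If \<open>d\<close> vanishes up to some \<open>t0\<close>, the second mean value theorem applied to each part shows
  that the integral is \<open>d t\<close> plus terms bounded by the oscillation of the parts near 0 times the
  maximum of \<open>\<bar>d\<bar>\<close> on the interval from \<open>t0\<close> to \<open>t\<close> (\<open>mono_kernel_integral\<close>). For \<open>t\<close> close to \<open>t0\<close> this
  forces the maximum to be 0, and the admissible distance does not depend on \<open>t0\<close>, so \<open>d\<close> vanishes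
  everywhere (\<open>volterra_unique\<close>).

  The remaining work is to justify that \<open>d\<close> is the integral of the representative of its weak
  derivative that the fractional derivative integrates. The increments of a continuous function
  are the integrals of any of its weak derivatives (\<open>weak_deriv_integral\<close>, by testing against smoothed indicators), two
  weak derivatives agree almost everywhere (\<open>weak_deriv_unique\<close>), and the product rule provides one
  for \<open>\<omega> y\<close> that is integrable on the whole interval (\<open>has_weak_deriv_mult\<close>).\<close>

section \<open>A continuously differentiable step\<close>

text \<open>\<open>smooth_step\<close> rises from 0 to 1 on the unit interval. Written as a second difference of the
  \<open>C\<^sup>1\<close> function \<open>(max 0 x)\<^sup>2\<close>, it is differentiable without any gluing at the break points, and its
  derivative is the same second difference of \<open>2 * max 0 x\<close>, the tent of unit area.\<close>

definition smooth_step :: "real \<Rightarrow> real" where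
  "smooth_step x = 2 * ((max 0 x)\<^sup>2 - 2 * (max 0 (x - 1/2))\<^sup>2 + (max 0 (x - 1))\<^sup>2)"

definition tent :: "real \<Rightarrow> real" where
  "tent x = 4 * (max 0 x - 2 * max 0 (x - 1/2) + max 0 (x - 1))"

lemma DERIV_pos_part_square: "((\<lambda>x::real. (max 0 x)\<^sup>2) has_real_derivative 2 * max 0 x) (at x)"
proof (cases x "0::real" rule: linorder_cases)
  case less
  have "((\<lambda>x::real. 0) has_real_derivative 0) (at x)" by simp
  then have "((\<lambda>x::real. (max 0 x)\<^sup>2) has_real_derivative 0) (at x)"
    by (rule has_field_derivative_transform_within_open[where S="{..<0}"]) (use less in auto)
  then show ?thesis using less by simp
next
  case greater
  have "((\<lambda>x::real. x\<^sup>2) has_real_derivative 2 * x) (at x)"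
    by (auto intro!: derivative_eq_intros)
  then have "((\<lambda>x::real. (max 0 x)\<^sup>2) has_real_derivative 2 * x) (at x)"
    by (rule has_field_derivative_transform_within_open[where S="{0<..}"]) (use greater in auto)
  then show ?thesis using greater by simp
next
  case equal
  have "((\<lambda>h::real. (max 0 h)\<^sup>2 / h) \<longlongrightarrow> 0) (at 0)"
  proof (rule tendsto_rabs_zero_cancel, rule tendsto_sandwich[where f="\<lambda>_. 0" and h="\<lambda>h. \<bar>h\<bar>"])
    show "\<forall>\<^sub>F h in at (0::real). \<bar>(max 0 h)\<^sup>2 / h\<bar> \<le> \<bar>h\<bar>"
      by (auto simp: max_def power2_eq_square)
  qed (auto intro!: tendsto_eq_intros)
  then show ?thesis using equal by (simp add: DERIV_def)
qed

lemma DERIV_smooth_step: "(smooth_step has_real_derivative tent x) (at x)"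
proof -
  have D: "((\<lambda>x. (max 0 (x - r))\<^sup>2) has_real_derivative 2 * max 0 (x - r)) (at x)" for r
  proof -
    have "((\<lambda>x. x - r) has_real_derivative 1) (at x)"
      by (auto intro!: derivative_eq_intros)
    from DERIV_chain2[OF DERIV_pos_part_square this] show ?thesis by simp
  qed
  show ?thesis
    unfolding smooth_step_def[abs_def] tent_def
    by (rule derivative_eq_intros DERIV_pos_part_square D refl)+ (simp add: algebra_simps)
qed

lemma DERIV_smooth_step_scaled:
  "((\<lambda>x. smooth_step ((x - c) / \<epsilon>)) has_real_derivative tent ((x - c) / \<epsilon>) / \<epsilon>) (at x)"
proof -
  have "((\<lambda>x. (x - c) / \<epsilon>) has_real_derivative 1 / \<epsilon>) (at x)"
    by (intro DERIV_cdivide) (auto intro!: derivative_eq_intros)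
  from DERIV_chain2[OF DERIV_smooth_step this] show ?thesis by simp
qed

lemma smooth_step_eq_0: "x \<le> 0 \<Longrightarrow> smooth_step x = 0"
  by (simp add: smooth_step_def max_def)

lemma smooth_step_eq_1: "1 \<le> x \<Longrightarrow> smooth_step x = 1"
  by (simp add: smooth_step_def max_def power2_eq_square algebra_simps)

lemma tent_eq_0: "x \<le> 0 \<or> 1 \<le> x \<Longrightarrow> tent x = 0"
  by (auto simp: tent_def max_def)

lemma tent_nonneg: "0 \<le> tent x"
  by (auto simp: tent_def max_def)

lemma continuous_on_tent [continuous_intros]:
  "continuous_on S f \<Longrightarrow> continuous_on S (\<lambda>x. tent (f x))"
  unfolding tent_def by (intro continuous_intros)

lemma smooth_step_mono: "x \<le> y \<Longrightarrow> smooth_step x \<le> smooth_step y"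
  by (rule DERIV_nonneg_imp_nondecreasing) (use DERIV_smooth_step tent_nonneg in blast)+

lemma smooth_step_bounds: "0 \<le> smooth_step x" "smooth_step x \<le> 1"
  using smooth_step_mono[of "min x 0" x] smooth_step_mono[of x "max x 1"]
  by (auto simp: smooth_step_eq_0 smooth_step_eq_1)

section \<open>The fundamental theorem for weak derivatives\<close>

lemma has_integral_approx_delta:
  assumes "0 < \<epsilon>"
  shows "((\<lambda>x. tent ((x - c) / \<epsilon>) / \<epsilon>) has_integral 1) {c..c + \<epsilon>}"
proof -
  have "((\<lambda>x. tent ((x - c) / \<epsilon>) / \<epsilon>) has_integral
      smooth_step ((c + \<epsilon> - c) / \<epsilon>) - smooth_step ((c - c) / \<epsilon>)) {c..c + \<epsilon>}"
  proof (rule fundamental_theorem_of_calculus)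
    fix x
    show "((\<lambda>x. smooth_step ((x - c) / \<epsilon>)) has_vector_derivative tent ((x - c) / \<epsilon>) / \<epsilon>)
        (at x within {c..c + \<epsilon>})"
      using DERIV_smooth_step_scaled[of c \<epsilon> x]
      by (simp add: has_real_derivative_iff_has_vector_derivative has_vector_derivative_at_within)
  qed (use assms in simp)
  then show ?thesis using assms by (simp add: smooth_step_eq_0 smooth_step_eq_1)
qed

text \<open>Integrals over an open interval reduce in this way to a compact interval, where continuous
  integrands are integrable.\<close>

lemma set_integral_support:
  fixes f :: "real \<Rightarrow> real"
  assumes "S \<subseteq> T" "\<And>x. x \<in> T \<Longrightarrow> x \<notin> S \<Longrightarrow> f x = 0"
  shows "set_integrable M T f \<longleftrightarrow> set_integrable M S f"
    and "(LINT x:T|M. f x) = (LINT x:S|M. f x)"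
proof -
  have eq: "(\<lambda>x. indicator T x *\<^sub>R f x) = (\<lambda>x. indicator S x *\<^sub>R f x)"
    using assms by (auto simp: indicator_def fun_eq_iff)
  show "set_integrable M T f \<longleftrightarrow> set_integrable M S f"
    and "(LINT x:T|M. f x) = (LINT x:S|M. f x)"
    by (simp_all only: set_integrable_def set_lebesgue_integral_def eq)
qed

text \<open>A rescaled tent has total mass 1 on the interval from \<open>c\<close> to \<open>c + \<epsilon>\<close>, so it averages the
  values of \<open>u\<close> there and differs from \<open>u c\<close> by at most the oscillation of \<open>u\<close>.\<close>

lemma approx_delta_integral:
  fixes u :: "real \<Rightarrow> real"
  assumes "0 < \<epsilon>" and T: "{c..c + \<epsilon>} \<subseteq> T" and u: "continuous_on {c..c + \<epsilon>} u"
  defines "w \<equiv> \<lambda>x. tent ((x - c) / \<epsilon>) / \<epsilon>"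
  shows "set_integrable lebesgue T (\<lambda>x. u x * w x)"
    and "(\<And>x. x \<in> {c..c + \<epsilon>} \<Longrightarrow> \<bar>u x - u c\<bar> \<le> e) \<Longrightarrow>
      \<bar>(LINT x:T|lebesgue. u x * w x) - u c\<bar> \<le> e"
proof -
  have w0: "w x = 0" if "x \<notin> {c..c + \<epsilon>}" for x
    using that assms(1) tent_eq_0[of "(x - c) / \<epsilon>"] by (auto simp: w_def field_simps)
  have "continuous_on {c..c + \<epsilon>} (\<lambda>x. u x * w x)"
    unfolding w_def using assms by (intro continuous_intros) auto
  then have I: "set_integrable lebesgue {c..c + \<epsilon>} (\<lambda>x. u x * w x)"
    by (rule absolutely_integrable_continuous_real)
  then show "set_integrable lebesgue T (\<lambda>x. u x * w x)"
    using set_integral_support(1)[OF T, of "\<lambda>x. u x * w x"] w0 by simp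
  assume e: "\<And>x. x \<in> {c..c + \<epsilon>} \<Longrightarrow> \<bar>u x - u c\<bar> \<le> e"
  have w1: "(w has_integral 1) {c..c + \<epsilon>}"
    unfolding w_def using assms(1) by (rule has_integral_approx_delta)
  have wn: "0 \<le> w x" for x using assms(1) by (simp add: w_def tent_nonneg)
  have "((\<lambda>x. u x * w x - u c * w x) has_integral
      (LINT x:{c..c + \<epsilon>}|lebesgue. u x * w x) - u c * 1) {c..c + \<epsilon>}"
    by (intro has_integral_diff has_integral_set_lebesgue I has_integral_mult_right w1)
  moreover have "((\<lambda>x. e * w x) has_integral e * 1) {c..c + \<epsilon>}"
    by (intro has_integral_mult_right w1)
  moreover have "norm (u x * w x - u c * w x) \<le> e * w x" if "x \<in> {c..c + \<epsilon>}" for x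
    using mult_right_mono[OF e[OF that] wn[of x]] wn[of x]
    by (simp add: abs_mult flip: left_diff_distrib)
  ultimately have "norm ((LINT x:{c..c + \<epsilon>}|lebesgue. u x * w x) - u c * 1) \<le> e * 1"
    by (metis (no_types, lifting) has_integral_integrable_integral integral_norm_bound_integral)
  then show "\<bar>(LINT x:T|lebesgue. u x * w x) - u c\<bar> \<le> e"
    using set_integral_support(2)[OF T, of "\<lambda>x. u x * w x" lebesgue] w0 by simp
qed

text \<open>The difference of two rescaled steps is 1 between \<open>c + \<epsilon>\<close> and \<open>d\<close> when \<open>\<epsilon>\<close> is small. Both steps
  rise to the right of their base point, which is why the support reaches to \<open>d + \<epsilon>\<close>.\<close>

lemma plateau_test_function:
  assumes "a < c" "c \<le> d" "d + \<epsilon> < b" "0 < \<epsilon>"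
  defines "\<psi> \<equiv> \<lambda>x. smooth_step ((x - c) / \<epsilon>) - smooth_step ((x - d) / \<epsilon>)"
  shows "C1_test_function a b \<psi>"
    and "deriv \<psi> x = tent ((x - c) / \<epsilon>) / \<epsilon> - tent ((x - d) / \<epsilon>) / \<epsilon>"
    and "x \<notin> {c..d + \<epsilon>} \<Longrightarrow> \<psi> x = 0"
proof -
  have D: "(\<psi> has_real_derivative tent ((x - c) / \<epsilon>) / \<epsilon> - tent ((x - d) / \<epsilon>) / \<epsilon>) (at x)" for x
    unfolding \<psi>_def by (intro derivative_intros DERIV_smooth_step_scaled)
  then show "deriv \<psi> x = tent ((x - c) / \<epsilon>) / \<epsilon> - tent ((x - d) / \<epsilon>) / \<epsilon>"
    by (rule DERIV_imp_deriv)
  have supp: "\<psi> x = 0" if "x \<notin> {c..d + \<epsilon>}" for x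
  proof (cases "x < c")
    case True
    then have "(x - c) / \<epsilon> \<le> 0" "(x - d) / \<epsilon> \<le> 0" using assms by (simp_all add: field_simps)
    then show ?thesis by (simp add: \<psi>_def smooth_step_eq_0)
  next
    case False
    then have "1 \<le> (x - c) / \<epsilon>" "1 \<le> (x - d) / \<epsilon>" using assms that by (simp_all add: field_simps)
    then show ?thesis by (simp add: \<psi>_def smooth_step_eq_1)
  qed
  then show "x \<notin> {c..d + \<epsilon>} \<Longrightarrow> \<psi> x = 0" by blast
  have "\<psi> C1_differentiable_on UNIV"
    unfolding C1_differentiable_on_def
    using D assms(4) by (auto simp: has_real_derivative_iff_has_vector_derivative
        intro!: exI[of _ "\<lambda>x. tent ((x - c) / \<epsilon>) / \<epsilon> - tent ((x - d) / \<epsilon>) / \<epsilon>"] continuous_intros)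
  moreover have "closure {x. \<psi> x \<noteq> 0} \<subseteq> {c..d + \<epsilon>}"
    by (rule closure_minimal) (use supp in \<open>auto simp del: atLeastAtMost_iff\<close>)
  ultimately show "C1_test_function a b \<psi>"
    using assms by (auto simp: C1_test_function_def)
qed

text \<open>The weak derivative is tested against plateau functions that shrink to the indicator of the
  interval from \<open>c\<close> to \<open>d\<close>. Their derivatives are an approximate Dirac mass at \<open>c\<close> minus one at \<open>d\<close>,
  so the left-hand side tends to \<open>u c - u d\<close> by continuity, while dominated convergence gives minus
  the integral of \<open>h\<close> on the right.\<close>

lemma weak_deriv_integral:
  assumes weak: "has_weak_deriv a b u h" and u: "continuous_on {a<..<b} u"
    and "a < c" "c \<le> d" "d < b"
  shows "integral {c..d} h = u d - u c"
proof -
  define \<delta> where "\<delta> = (b - d) / 2"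
  have \<delta>: "0 < \<delta>" "d + \<delta> < b" using assms by (auto simp: \<delta>_def field_simps)
  define \<epsilon> where "\<epsilon> n = \<delta> / real (Suc n)" for n
  have \<epsilon>: "0 < \<epsilon> n" "\<epsilon> n \<le> \<delta>" for n
    using \<delta> by (auto simp: \<epsilon>_def field_simps)
  have "(\<lambda>n. \<delta> * (1 / real (Suc n))) \<longlonglongrightarrow> \<delta> * 0"
    by (intro tendsto_mult_left LIMSEQ_Suc lim_1_over_n)
  then have \<epsilon>0: "\<epsilon> \<longlonglongrightarrow> 0" by (simp add: \<epsilon>_def[abs_def])
  define \<psi> where "\<psi> n x = smooth_step ((x - c) / \<epsilon> n) - smooth_step ((x - d) / \<epsilon> n)" for n x
  have \<psi>: "C1_test_function a b (\<psi> n)"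
    "deriv (\<psi> n) x = tent ((x - c) / \<epsilon> n) / \<epsilon> n - tent ((x - d) / \<epsilon> n) / \<epsilon> n"
    "x \<notin> {c..d + \<epsilon> n} \<Longrightarrow> \<psi> n x = 0" for n x
    unfolding \<psi>_def by (rule plateau_test_function[of a c d "\<epsilon> n" b];
      use assms(3,4) \<epsilon>[of n] \<delta> in simp)+
  have delta: "(\<lambda>n. LINT x:{a<..<b}|lebesgue. u x * (tent ((x - r) / \<epsilon> n) / \<epsilon> n)) \<longlonglongrightarrow> u r"
    and int: "set_integrable lebesgue {a<..<b} (\<lambda>x. u x * (tent ((x - r) / \<epsilon> n) / \<epsilon> n))"
    if r: "r \<in> {c, d}" for r n
  proof -
    have sub: "{r..r + \<epsilon> n} \<subseteq> {a<..<b}" for n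
      using r assms(3-5) \<epsilon>[of n] \<delta> by auto
    have cont: "continuous_on {r..r + \<epsilon> n} u" for n
      using continuous_on_subset[OF u sub] .
    show "set_integrable lebesgue {a<..<b} (\<lambda>x. u x * (tent ((x - r) / \<epsilon> n) / \<epsilon> n))"
      by (rule approx_delta_integral(1)[OF \<epsilon>(1) sub cont])
    show "(\<lambda>n. LINT x:{a<..<b}|lebesgue. u x * (tent ((x - r) / \<epsilon> n) / \<epsilon> n)) \<longlonglongrightarrow> u r"
    proof (rule LIMSEQ_I)
      fix e :: real assume "e > 0"
      have "isCont u r" using r assms(3-5) u by (auto simp: continuous_on_eq_continuous_at)
      then obtain \<eta> where "\<eta> > 0" and \<eta>: "\<And>x. \<bar>x - r\<bar> < \<eta> \<Longrightarrow> \<bar>u x - u r\<bar> < e / 2"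
        using \<open>e > 0\<close> half_gt_zero[of e] unfolding continuous_at_eps_delta dist_real_def by meson
      obtain n0 where n0: "\<And>n. n \<ge> n0 \<Longrightarrow> \<epsilon> n < \<eta>"
        using order_tendstoD(2)[OF \<epsilon>0 \<open>\<eta> > 0\<close>] unfolding eventually_sequentially by blast
      have "\<bar>(LINT x:{a<..<b}|lebesgue. u x * (tent ((x - r) / \<epsilon> n) / \<epsilon> n)) - u r\<bar> \<le> e / 2"
        if "n \<ge> n0" for n
        by (rule approx_delta_integral(2)[OF \<epsilon>(1) sub cont])
          (use \<eta> n0[OF that] in \<open>auto intro!: less_imp_le\<close>)
      then show "\<exists>n0. \<forall>n\<ge>n0.
          norm ((LINT x:{a<..<b}|lebesgue. u x * (tent ((x - r) / \<epsilon> n) / \<epsilon> n)) - u r) < e"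
        using \<open>e > 0\<close> by (intro exI[of _ n0]) force
    qed
  qed
  have "(\<lambda>n. (LINT x:{a<..<b}|lebesgue. u x * (tent ((x - c) / \<epsilon> n) / \<epsilon> n))
      - (LINT x:{a<..<b}|lebesgue. u x * (tent ((x - d) / \<epsilon> n) / \<epsilon> n))) \<longlonglongrightarrow> u c - u d"
    by (intro tendsto_diff delta) auto
  moreover have "(LINT x:{a<..<b}|lebesgue. u x * (tent ((x - c) / \<epsilon> n) / \<epsilon> n))
      - (LINT x:{a<..<b}|lebesgue. u x * (tent ((x - d) / \<epsilon> n) / \<epsilon> n))
    = - (LINT x:{a<..<b}|lebesgue. h x * \<psi> n x)" for n
  proof -
    have "(LINT x:{a<..<b}|lebesgue. u x * deriv (\<psi> n) x) = - (LINT x:{a<..<b}|lebesgue. h x * \<psi> n x)"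
      using weak \<psi>(1) by (simp add: has_weak_deriv_def)
    then show ?thesis
      unfolding \<psi>(2) right_diff_distrib by (subst (asm) set_integral_diff(2)[OF int int]) auto
  qed
  ultimately have "(\<lambda>n. - (LINT x:{a<..<b}|lebesgue. h x * \<psi> n x)) \<longlonglongrightarrow> u c - u d" by simp
  then have lim1: "(\<lambda>n. LINT x:{a<..<b}|lebesgue. h x * \<psi> n x) \<longlonglongrightarrow> u d - u c"
    using tendsto_minus by fastforce
  have hI: "set_integrable lebesgue {c..d + \<delta>} h"
  proof -
    have "{c..d + \<delta>} \<subseteq> {a<..<b}" using \<delta> assms by auto
    then show ?thesis using weak by (auto simp: has_weak_deriv_def locally_integrable_def)
  qed
  have "(\<lambda>n. LINT x|lebesgue. indicator {a<..<b} x *\<^sub>R (h x * \<psi> n x))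
      \<longlonglongrightarrow> (LINT x|lebesgue. indicator {c<..d} x *\<^sub>R h x)"
  proof (rule integral_dominated_convergence[where w="\<lambda>x. norm (indicator {c..d + \<delta>} x *\<^sub>R h x)"])
    have H: "integrable lebesgue (\<lambda>x. indicator {c..d + \<delta>} x *\<^sub>R h x)"
      using hI by (simp add: set_integrable_def)
    then show "integrable lebesgue (\<lambda>x. norm (indicator {c..d + \<delta>} x *\<^sub>R h x))"
      by (rule integrable_norm)
    have eq: "indicator {a<..<b} x *\<^sub>R (h x * \<psi> n x) = (indicator {c..d + \<delta>} x *\<^sub>R h x) * \<psi> n x" for n x
      using \<psi>(3)[of x n] \<epsilon>[of n] \<delta> assms(3,4) by (auto simp: indicator_def)
    have "\<psi> n \<in> borel_measurable borel" for n
      unfolding \<psi>_def smooth_step_def by measurable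
    then have "\<psi> n \<in> borel_measurable lebesgue" for n
      by (intro measurable_completion) simp
    then show "(\<lambda>x. indicator {a<..<b} x *\<^sub>R (h x * \<psi> n x)) \<in> borel_measurable lebesgue" for n
      unfolding eq using H by (intro borel_measurable_times) auto
    have "set_integrable lebesgue {c<..d} h"
      by (rule set_integrable_subset[OF hI]) (use \<delta> in auto)
    then show "(\<lambda>x. indicator {c<..d} x *\<^sub>R h x) \<in> borel_measurable lebesgue"
      unfolding set_integrable_def by (rule borel_measurable_integrable)
    have "\<bar>\<psi> n x\<bar> \<le> 1" for n x
      using smooth_step_bounds[of "(x - c) / \<epsilon> n"] smooth_step_bounds[of "(x - d) / \<epsilon> n"] by (auto simp: \<psi>_def)
    then show "AE x in lebesgue. norm (indicator {a<..<b} x *\<^sub>R (h x * \<psi> n x))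
        \<le> norm (indicator {c..d + \<delta>} x *\<^sub>R h x)" for n
      unfolding eq by (intro AE_I2) (simp add: abs_mult mult_left_le)
    have lim: "(\<lambda>n. smooth_step ((x - r) / \<epsilon> n)) \<longlonglongrightarrow> (if r < x then 1 else 0)" for r x
    proof (cases "r < x")
      case True
      then have "eventually (\<lambda>n. \<epsilon> n < x - r) sequentially"
        using order_tendstoD(2)[OF \<epsilon>0, of "x - r"] by simp
      then have "eventually (\<lambda>n. smooth_step ((x - r) / \<epsilon> n) = 1) sequentially"
        by eventually_elim (use \<epsilon> in \<open>auto intro!: smooth_step_eq_1 simp: field_simps\<close>)
      then show ?thesis using True by (simp add: tendsto_eventually)
    next
      case False
      then have "(x - r) / \<epsilon> n \<le> 0" for n using \<epsilon>(1)[of n] by (simp add: field_simps)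
      then show ?thesis using False by (simp add: smooth_step_eq_0)
    qed
    show "AE x in lebesgue. (\<lambda>n. indicator {a<..<b} x *\<^sub>R (h x * \<psi> n x))
        \<longlonglongrightarrow> indicator {c<..d} x *\<^sub>R h x"
    proof (rule AE_I2)
      fix x
      have "(\<lambda>n. (indicator {c..d + \<delta>} x *\<^sub>R h x) * \<psi> n x) \<longlonglongrightarrow>
        (indicator {c..d + \<delta>} x *\<^sub>R h x) * ((if c < x then 1 else 0) - (if d < x then 1 else 0))"
        unfolding \<psi>_def by (intro tendsto_intros lim)
      also have "(indicator {c..d + \<delta>} x *\<^sub>R h x) * ((if c < x then 1 else 0) - (if d < x then 1 else 0))
        = indicator {c<..d} x *\<^sub>R h x"
        using \<delta> assms(4) by (auto simp: indicator_def)
      finally show "(\<lambda>n. indicator {a<..<b} x *\<^sub>R (h x * \<psi> n x)) \<longlonglongrightarrow> indicator {c<..d} x *\<^sub>R h x"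
        unfolding eq .
    qed
  qed
  then have "u d - u c = (LINT x:{c<..d}|lebesgue. h x)"
    using LIMSEQ_unique[OF lim1] by (simp add: set_lebesgue_integral_def)
  also have "\<dots> = integral {c<..d} h"
    by (rule set_lebesgue_integral_eq_integral(2))
      (rule set_integrable_subset[OF hI], use \<delta> in auto)
  also have "\<dots> = integral {c..d} h"
    by (rule integral_spike_set) (auto intro: negligible_subset[of "{c}"])
  finally show ?thesis by simp
qed

section \<open>Almost everywhere uniqueness of weak derivatives\<close>

text \<open>The positive and the negative part of \<open>q\<close> are densities of two finite measures that agree on
  half-lines, hence agree; equal densities coincide almost everywhere, and a number equal to its
  own negative vanishes.\<close>

lemma AE_eq_0_if_integrals_eq_0:
  fixes q :: "real \<Rightarrow> real"
  assumes q: "integrable lebesgue q" and 0: "\<And>x. (LINT t:{x<..}|lebesgue. q t) = 0"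
  shows "AE x in lebesgue. q x = 0"
proof -
  obtain q' where q'[measurable]: "q' \<in> borel_measurable lborel" and ae: "AE x in lborel. q x = q' x"
    using completion_ex_borel_measurable_real[OF borel_measurable_integrable[OF q]] by auto
  have ae': "AE x in lebesgue. q x = q' x" using ae by (rule AE_completion)
  have m': "q' \<in> borel_measurable lebesgue" using q' by (rule measurable_completion)
  have "integrable lebesgue q'"
    using integrable_cong_AE[OF borel_measurable_integrable[OF q] m' ae'] q by simp
  then have I': "integrable lborel q'" by (simp add: integrable_completion)
  have I: "integrable lborel (\<lambda>t. indicator {x<..} t * q' t)" for x
    by (rule integrable_mult_indicator[where 'b=real, simplified real_scaleR_def, OF _ I']) simp
  have zero': "(LINT t|lborel. indicator {x<..} t * q' t) = 0" for x
  proof -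
    have "(LINT t|lborel. indicator {x<..} t * q' t) = (LINT t|lebesgue. indicator {x<..} t * q' t)"
      by (rule integral_completion[symmetric]) simp
    also have "\<dots> = (LINT t|lebesgue. indicator {x<..} t * q t)"
      using ae' by (intro integral_cong_AE borel_measurable_times borel_measurable_indicator
          borel_measurable_integrable[OF q] m') (auto elim: eventually_mono)
    also have "\<dots> = 0" using 0 by (simp add: set_lebesgue_integral_def)
    finally show ?thesis .
  qed
  \<comment> \<open>\<open>ennreal\<close> truncates negative numbers to 0, so these are the positive and the negative part.\<close>
  define P where "P = density lborel (\<lambda>t. ennreal (q' t))"
  define M where "M = density lborel (\<lambda>t. ennreal (- q' t))"
  have P: "emeasure P {x<..} = (\<integral>\<^sup>+t. ennreal (indicator {x<..} t * q' t) \<partial>lborel)" for x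
    unfolding P_def by (subst emeasure_density) (auto intro!: nn_integral_cong simp: indicator_def)
  have M: "emeasure M {x<..} = (\<integral>\<^sup>+t. ennreal (- (indicator {x<..} t * q' t)) \<partial>lborel)" for x
    unfolding M_def by (subst emeasure_density) (auto intro!: nn_integral_cong simp: indicator_def)
  have fin: "emeasure P {x<..} < \<infinity>" "emeasure M {x<..} < \<infinity>" for x
    unfolding P M using I[of x] by (auto simp: real_integrable_def less_top)
  have "emeasure P {x<..} = emeasure M {x<..}" for x
  proof -
    have "enn2real (emeasure P {x<..}) = enn2real (emeasure M {x<..})"
      using zero'[of x] unfolding real_lebesgue_integral_def[OF I[of x]] P M by simp
    then show ?thesis using fin[of x]
      by (metis ennreal_enn2real less_irrefl infinity_ennreal_def)
  qed
  then have "P = M"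
    by (intro measure_eqI_lessThan fin) (simp_all add: P_def M_def)
  then have "AE t in lborel. ennreal (q' t) = ennreal (- q' t)"
    unfolding P_def M_def by (intro sigma_finite_measure.density_unique[OF lborel.sigma_finite_measure_axioms]) auto
  with ae have "AE t in lborel. q t = 0"
  proof eventually_elim
    case (elim t)
    have "ennreal (- q' t) = 0 \<or> ennreal (q' t) = 0"
      by (cases "0 \<le> q' t") (auto simp: ennreal_neg)
    then have "ennreal (- q' t) = 0 \<and> ennreal (q' t) = 0"
      using elim(2) by auto
    then have "q' t = 0" by (auto simp: ennreal_eq_0_iff)
    then show ?case using elim(1) by simp
  qed
  then show ?thesis by (rule AE_completion)
qed

lemma AE_eq_0_on_interval:
  fixes q :: "real \<Rightarrow> real"
  assumes q: "set_integrable lebesgue {a..b} q"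
    and 0: "\<And>c d. a \<le> c \<Longrightarrow> c \<le> d \<Longrightarrow> d \<le> b \<Longrightarrow> integral {c..d} q = 0"
  shows "AE x in lebesgue. x \<in> {a..b} \<longrightarrow> q x = 0"
proof -
  have "(LINT t:{x<..}|lebesgue. indicator {a..b} t *\<^sub>R q t) = 0" for x
  proof -
    have "(LINT t:{x<..}|lebesgue. indicator {a..b} t *\<^sub>R q t) = (LINT t:{x<..} \<inter> {a..b}|lebesgue. q t)"
      unfolding set_lebesgue_integral_def
      by (rule Bochner_Integration.integral_cong) (auto simp: indicator_def)
    also have "\<dots> = integral ({x<..} \<inter> {a..b}) q"
      by (intro set_lebesgue_integral_eq_integral(2) set_integrable_subset[OF q]) auto
    also have "\<dots> = integral {max x a..b} q"
      by (rule integral_spike_set) (auto intro: negligible_subset[of "{x}"])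
    also have "\<dots> = 0" by (cases "max x a \<le> b") (auto intro: 0)
    finally show ?thesis .
  qed
  then have "AE x in lebesgue. indicator {a..b} x *\<^sub>R q x = 0"
    using q unfolding set_integrable_def by (intro AE_eq_0_if_integrals_eq_0)
  then show ?thesis by (rule eventually_mono) (auto simp: indicator_def split: if_splits)
qed

text \<open>Weak derivatives are only locally integrable, so the comparison runs on compact subintervals
  that exhaust the open interval.\<close>

lemma weak_deriv_unique:
  assumes h: "has_weak_deriv a b u h" and k: "has_weak_deriv a b u k" and u: "continuous_on {a<..<b} u"
  shows "AE x in lebesgue. x \<in> {a<..<b} \<longrightarrow> h x = k x"
proof -
  define c where "c n = a + 1 / real (Suc n)" for n
  define d where "d n = b - 1 / real (Suc n)" for n
  have cd: "a < c n" "d n < b" for n by (auto simp: c_def d_def)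
  have "AE x in lebesgue. x \<in> {c n..d n} \<longrightarrow> h x - k x = 0" for n
  proof (rule AE_eq_0_on_interval)
    have sub: "{c n..d n} \<subseteq> {a<..<b}" using cd[of n] by auto
    then have hk: "set_integrable lebesgue {c n..d n} h" "set_integrable lebesgue {c n..d n} k"
      using h k unfolding has_weak_deriv_def locally_integrable_def by blast+
    then show "set_integrable lebesgue {c n..d n} (\<lambda>x. h x - k x)"
      by (rule set_integral_diff)
    fix r s assume rs: "c n \<le> r" "r \<le> s" "s \<le> d n"
    then have "set_integrable lebesgue {r..s} h" "set_integrable lebesgue {r..s} k"
      by (auto intro!: hk[THEN set_integrable_subset])
    then have "integral {r..s} (\<lambda>x. h x - k x) = integral {r..s} h - integral {r..s} k"
      by (intro integral_diff set_lebesgue_integral_eq_integral)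
    also have "\<dots> = 0"
      using weak_deriv_integral[OF h u, of r s] weak_deriv_integral[OF k u, of r s] rs cd[of n] by simp
    finally show "integral {r..s} (\<lambda>x. h x - k x) = 0" .
  qed
  then have "AE x in lebesgue. \<forall>n. x \<in> {c n..d n} \<longrightarrow> h x - k x = 0"
    unfolding AE_all_countable by blast
  then show ?thesis
  proof (rule eventually_mono, intro impI)
    fix x assume *: "\<forall>n. x \<in> {c n..d n} \<longrightarrow> h x - k x = 0" and x: "x \<in> {a<..<b}"
    from x obtain n where n: "inverse (real (Suc n)) < min (x - a) (b - x)"
      using reals_Archimedean[of "min (x - a) (b - x)"] by auto
    then have "x \<in> {c n..d n}" by (auto simp: c_def d_def inverse_eq_divide)
    then show "h x = k x" using * by auto
  qed
qed

section \<open>The product rule\<close>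

text \<open>Outside the support of \<open>\<psi>\<close> the product vanishes, whatever \<open>w\<close> is there; hence a weight that is
  differentiable on the open interval only still turns test functions into test functions, and
  the defining identity of a weak derivative of \<open>u\<close> can be tested against \<open>w \<psi>\<close>.\<close>

lemma C1_test_function_mult:
  assumes \<psi>: "C1_test_function a b \<psi>"
    and w: "\<And>t. t \<in> {a<..<b} \<Longrightarrow> (w has_real_derivative w' t) (at t)"
    and w': "continuous_on {a<..<b} w'"
  shows "C1_test_function a b (\<lambda>x. w x * \<psi> x)"
    and "x \<in> {a<..<b} \<Longrightarrow> deriv (\<lambda>x. w x * \<psi> x) x = w' x * \<psi> x + w x * deriv \<psi> x"
    and "continuous_on UNIV \<psi>" "continuous_on UNIV (deriv \<psi>)"
proof -
  define C where "C = closure {x. \<psi> x \<noteq> 0}"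
  have C: "closed C" "C \<subseteq> {a<..<b}" using \<psi> by (auto simp: C_def C1_test_function_def)
  have \<psi>0: "\<psi> x = 0" if "x \<notin> C" for x
    using that closure_subset[of "{x. \<psi> x \<noteq> 0}"] by (auto simp: C_def)
  obtain D where D: "\<And>x. (\<psi> has_real_derivative D x) (at x)" "continuous_on UNIV D"
    using \<psi> by (auto simp: C1_test_function_def C1_differentiable_on_def
      has_real_derivative_iff_has_vector_derivative)
  have dD: "deriv \<psi> = D" using D(1) by (auto intro!: DERIV_imp_deriv ext)
  then show "continuous_on UNIV (deriv \<psi>)" using D by simp
  show c\<psi>: "continuous_on UNIV \<psi>" using D(1) DERIV_isCont continuous_at_imp_continuous_on by blast
  have D0: "D x = 0" if "x \<notin> C" for x
  proof -
    have "((\<lambda>_. 0) has_real_derivative 0) (at x)" by simp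
    then have "(\<psi> has_real_derivative 0) (at x)"
      by (rule has_field_derivative_transform_within_open[where S="- C"]) (use that C \<psi>0 in auto)
    then show ?thesis using D(1) DERIV_unique by blast
  qed
  \<comment> \<open>The two descriptions of the derivative agree, one being manifestly continuous on the open
    interval and the other on the complement of the support.\<close>
  define E where "E x = (if x \<in> C then w' x * \<psi> x + w x * D x else 0)" for x
  have E: "E x = w' x * \<psi> x + w x * D x" for x by (simp add: E_def \<psi>0 D0)
  have der: "((\<lambda>x. w x * \<psi> x) has_real_derivative E x) (at x)" for x
  proof (cases "x \<in> C")
    case True
    then show ?thesis unfolding E
      using C by (auto intro!: derivative_eq_intros w D)
  next
    case False
    have "((\<lambda>_. 0) has_real_derivative 0) (at x)" by simp
    then have "((\<lambda>x. w x * \<psi> x) has_real_derivative 0) (at x)"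
      by (rule has_field_derivative_transform_within_open[where S="- C"]) (use False C \<psi>0 in auto)
    then show ?thesis using False by (simp add: E_def)
  qed
  then show "deriv (\<lambda>x. w x * \<psi> x) x = w' x * \<psi> x + w x * deriv \<psi> x"
    using DERIV_imp_deriv[OF der] by (simp add: E dD)
  have cw: "continuous_on {a<..<b} w"
    using w DERIV_isCont by (blast intro: continuous_at_imp_continuous_on)
  have "continuous_on {a<..<b} (\<lambda>x. w' x * \<psi> x + w x * D x)"
    by (intro continuous_intros w' cw continuous_on_subset[OF c\<psi>] continuous_on_subset[OF D(2)]) auto
  then have "continuous_on {a<..<b} E" by (simp add: E[abs_def])
  moreover have "continuous_on (- C) E"
    by (rule continuous_on_eq[OF continuous_on_const]) (auto simp: E_def)
  ultimately have "continuous_on ({a<..<b} \<union> - C) E"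
    using C by (intro continuous_on_open_Un) auto
  moreover have "{a<..<b} \<union> - C = UNIV" using C by auto
  ultimately have "continuous_on UNIV E" by simp
  then have "(\<lambda>x. w x * \<psi> x) C1_differentiable_on UNIV"
    using der by (auto simp: C1_differentiable_on_def has_real_derivative_iff_has_vector_derivative)
  moreover have "closure {x. w x * \<psi> x \<noteq> 0} \<subseteq> C"
    by (rule closure_minimal) (use \<psi>0 C in auto)
  ultimately show "C1_test_function a b (\<lambda>x. w x * \<psi> x)"
    using C by (auto simp: C1_test_function_def)
qed

text \<open>On a bounded interval \<open>\<bar>h\<bar> \<le> 1 + h\<^sup>2\<close> suffices as an integrable bound.\<close>

lemma set_integrable_L2:
  assumes "L2_interval a b h"
  shows "set_integrable lebesgue {a<..<b} h"
proof -
  have m: "set_borel_measurable lebesgue {a<..<b} h"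
    and i: "set_integrable lebesgue {a<..<b} (\<lambda>x. (h x)\<^sup>2)"
    using assms by (auto simp: L2_interval_def)
  have "(\<lambda>x. 1::real) absolutely_integrable_on {a<..<b}"
    by (intro absolutely_integrable_on_const) simp
  then have "set_integrable lebesgue {a<..<b} (\<lambda>x. 1 + (h x)\<^sup>2)"
    using i by (rule set_integral_add)
  then show ?thesis
  proof (rule set_integrable_bound)
    have "\<bar>h x\<bar> \<le> 1 + (h x)\<^sup>2" for x
      using zero_le_power2[of "\<bar>h x\<bar> - 1"] zero_le_power2[of "h x"]
      by (simp add: power2_diff)
    then show "AE x in lebesgue. x \<in> {a<..<b} \<longrightarrow> norm (h x) \<le> norm (1 + (h x)\<^sup>2)"
      by (intro AE_I2) (simp add: abs_of_nonneg)
  qed (rule m)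
qed

lemma set_integrable_continuous_mult:
  fixes f g :: "real \<Rightarrow> real"
  assumes f: "continuous_on {a..b} f" and g: "set_integrable lebesgue S g"
    and S: "S \<subseteq> {a..b}" "S \<in> sets lebesgue"
  shows "set_integrable lebesgue S (\<lambda>x. f x * g x)"
proof (rule absolutely_integrable_bounded_measurable_product_real[OF _ S(2) _ g])
  have "f \<in> borel_measurable (lebesgue_on {a..b})"
    using f by (intro continuous_imp_measurable_on_sets_lebesgue) auto
  then show "f \<in> borel_measurable (lebesgue_on S)"
    using measurable_restrict_mono S(1) by blast
  show "bounded (f ` S)"
    using compact_imp_bounded[OF compact_continuous_image[OF f]] S(1)
    by (meson bounded_subset compact_Icc image_mono)
qed

text \<open>Testing \<open>w u\<close> against \<open>\<psi>\<close> is testing \<open>u\<close> against \<open>w \<psi>\<close>, up to the term \<open>w' u \<psi>\<close> that the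
  classical product rule produces.\<close>

lemma has_weak_deriv_mult:
  assumes w: "\<And>t. t \<in> {a..b} \<Longrightarrow> (w has_real_derivative w' t) (at t within {a..b})"
    and w': "continuous_on {a..b} w'"
    and u: "continuous_on {a..b} u" and h: "set_integrable lebesgue {a<..<b} h"
    and weak: "has_weak_deriv a b u h"
  shows "has_weak_deriv a b (\<lambda>x. w x * u x) (\<lambda>x. w' x * u x + w x * h x)"
    and "set_integrable lebesgue {a<..<b} (\<lambda>x. w' x * u x + w x * h x)"
proof -
  have cw: "continuous_on {a..b} w"
    using w DERIV_continuous_on by blast
  have w_at: "(w has_real_derivative w' t) (at t)" if "t \<in> {a<..<b}" for t
    using w[of t] that by (simp add: at_within_Icc_at)
  have cw'0: "continuous_on {a<..<b} w'" using w' by (rule continuous_on_subset) auto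
  have mono: "set_integrable lebesgue S f" if "set_integrable lebesgue {a..b} f" "S \<subseteq> {a..b}" 
    "S \<in> sets lebesgue" for S and f :: "real \<Rightarrow> real"
    using set_integrable_subset that by blast
  have cont_int: "set_integrable lebesgue {a<..<b} f" if "continuous_on {a..b} f" for f :: "real \<Rightarrow> real"
    by (rule mono[OF absolutely_integrable_continuous_real[OF that]]) auto
  show int: "set_integrable lebesgue {a<..<b} (\<lambda>x. w' x * u x + w x * h x)"
    by (intro set_integral_add cont_int continuous_on_mult w' u
        set_integrable_continuous_mult[OF cw h]) auto
  have loc: "locally_integrable a b f" if "set_integrable lebesgue {a<..<b} f" for f
    unfolding locally_integrable_def using set_integrable_subset[OF that] by auto
  show "has_weak_deriv a b (\<lambda>x. w x * u x) (\<lambda>x. w' x * u x + w x * h x)"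
    unfolding has_weak_deriv_def
  proof (intro conjI allI impI)
    show "locally_integrable a b (\<lambda>x. w x * u x)"
      by (intro loc cont_int continuous_on_mult cw u)
    show "locally_integrable a b (\<lambda>x. w' x * u x + w x * h x)"
      by (intro loc int)
    fix \<psi> assume \<psi>: "C1_test_function a b \<psi>"
    note test = C1_test_function_mult[OF \<psi> w_at cw'0]
    have c\<psi>: "continuous_on {a..b} \<psi>" and c\<psi>': "continuous_on {a..b} (deriv \<psi>)"
      using test(3,4) continuous_on_subset by blast+
    have i1: "set_integrable lebesgue {a<..<b} (\<lambda>x. w x * u x * deriv \<psi> x)"
      and i2: "set_integrable lebesgue {a<..<b} (\<lambda>x. w' x * u x * \<psi> x)"
      by (intro cont_int continuous_intros cw w' u c\<psi> c\<psi>')+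
    have "set_integrable lebesgue {a<..<b} (\<lambda>x. (w x * \<psi> x) * h x)"
      by (intro set_integrable_continuous_mult[where a=a and b=b, OF _ h] continuous_intros cw c\<psi>) auto
    then have i3: "set_integrable lebesgue {a<..<b} (\<lambda>x. w x * h x * \<psi> x)"
      by (simp add: mult_ac)
    have "(LINT x:{a<..<b}|lebesgue. u x * deriv (\<lambda>x. w x * \<psi> x) x)
        = - (LINT x:{a<..<b}|lebesgue. h x * (w x * \<psi> x))"
      using weak test(1) by (simp add: has_weak_deriv_def)
    moreover have "(LINT x:{a<..<b}|lebesgue. u x * deriv (\<lambda>x. w x * \<psi> x) x)
        = (LINT x:{a<..<b}|lebesgue. w' x * u x * \<psi> x + w x * u x * deriv \<psi> x)"
      by (intro set_lebesgue_integral_cong allI impI) (simp_all only: test(2), simp_all add: algebra_simps)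
    moreover have "\<dots> = (LINT x:{a<..<b}|lebesgue. w' x * u x * \<psi> x)
        + (LINT x:{a<..<b}|lebesgue. w x * u x * deriv \<psi> x)"
      by (rule set_integral_add(2)[OF i2 i1])
    moreover have "(LINT x:{a<..<b}|lebesgue. (w' x * u x + w x * h x) * \<psi> x)
        = (LINT x:{a<..<b}|lebesgue. w' x * u x * \<psi> x) + (LINT x:{a<..<b}|lebesgue. w x * h x * \<psi> x)"
      unfolding distrib_right by (rule set_integral_add(2)[OF i2 i3])
    moreover have "(LINT x:{a<..<b}|lebesgue. w x * h x * \<psi> x)
        = (LINT x:{a<..<b}|lebesgue. h x * (w x * \<psi> x))"
      by (simp add: mult_ac)
    ultimately show "(LINT x:{a<..<b}|lebesgue. w x * u x * deriv \<psi> x)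
        = - (LINT x:{a<..<b}|lebesgue. (w' x * u x + w x * h x) * \<psi> x)"
      by linarith
  qed
qed

text \<open>Integrability up to the end points makes the indefinite integral continuous on the closed
  interval, so \<open>u\<close> minus that integral, constant inside, is constant up to the boundary.\<close>

lemma weak_deriv_integral_closed:
  assumes "a < b" and weak: "has_weak_deriv a b u h" and u: "continuous_on {a..b} u"
    and h: "set_integrable lebesgue {a<..<b} h" and "t \<in> {a..b}"
  shows "integral {a..t} h = u t - u a"
proof -
  have u0: "continuous_on {a<..<b} u" using u by (rule continuous_on_subset) auto
  have "h integrable_on {a<..<b}" using h by (rule set_lebesgue_integral_eq_integral)
  then have hab: "h integrable_on {a..b}"
    by (simp add: integrable_on_Icc_iff_Ioo)
  define I where "I s = integral {a..s} h" for s
  have cI: "continuous_on {a..b} I"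
    unfolding I_def[abs_def] using hab by (rule indefinite_integral_continuous_1)
  have eq: "u s - I s = u r - I r" if "a < r" "r \<le> s" "s < b" for r s
  proof -
    have "I r + integral {r..s} h = I s"
      unfolding I_def using that by (intro Henstock_Kurzweil_Integration.integral_combine
          integrable_on_subinterval[OF hab]) auto
    then show ?thesis
      using weak_deriv_integral[OF weak u0 that] by simp
  qed
  define m where "m = (a + b) / 2"
  have m: "a < m" "m < b" using \<open>a < b\<close> by (auto simp: m_def)
  have const: "u s - I s = u m - I m" if "s \<in> {a<..<b}" for s
    using eq[of m s] eq[of s m] m that by (cases "m \<le> s") auto
  have "closure {a<..<b} \<subseteq> {s \<in> {a..b}. u s - I s = u m - I m}"
  proof (rule closure_minimal)
    show "closed {s \<in> {a..b}. u s - I s = u m - I m}"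
      by (intro continuous_closed_preimage_constant continuous_on_diff u cI closed_atLeastAtMost)
  qed (use const in auto)
  then have "u t - I t = u m - I m" "u a - I a = u m - I m"
    using assms(1,5) by (auto simp: subset_iff)
  then show ?thesis by (simp add: I_def)
qed

text \<open>The weak derivative in the definition of the fractional derivative is an arbitrary
  representative. The product rule exhibits an integrable one, and uniqueness transfers its
  integrability to the chosen one.\<close>

lemma weak_deriv_weighted:
  assumes "a < b" and w: "C1_closed_interval a b w"
    and y: "y \<in> sobolev_H1 a b" "continuous_on {a..b} y"
  defines "k \<equiv> weak_deriv a b (\<lambda>r. w r * y r)"
  shows "set_integrable lebesgue {a..b} k"
    and "t \<in> {a..b} \<Longrightarrow> integral {a..t} k = w t * y t - w a * y a"
proof -
  obtain w' where w': "continuous_on {a..b} w'"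
    "\<And>t. t \<in> {a..b} \<Longrightarrow> (w has_real_derivative w' t) (at t within {a..b})"
    using w by (auto simp: C1_closed_interval_def)
  obtain h where h: "L2_interval a b h" "has_weak_deriv a b y h"
    using y(1) by (auto simp: sobolev_H1_def)
  define g where "g x = w' x * y x + w x * h x" for x
  have g: "has_weak_deriv a b (\<lambda>r. w r * y r) g" "set_integrable lebesgue {a<..<b} g"
    unfolding g_def[abs_def] using has_weak_deriv_mult[OF w'(2,1) y(2) set_integrable_L2[OF h(1)] h(2)] by auto
  then have k: "has_weak_deriv a b (\<lambda>r. w r * y r) k"
    unfolding k_def weak_deriv_def by (metis someI)
  have cont: "continuous_on {a..b} (\<lambda>r. w r * y r)"
    using DERIV_continuous_on[OF w'(2)] y(2) by (intro continuous_on_mult) auto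
  then have "AE x in lebesgue. x \<in> {a<..<b} \<longrightarrow> g x = k x"
    by (intro weak_deriv_unique[OF g(1) k] continuous_on_subset[OF cont]) auto
  then have ae: "AE x in lebesgue. indicator {a<..<b} x *\<^sub>R g x = indicator {a<..<b} x *\<^sub>R k x"
    by (rule eventually_mono) (auto simp: indicator_def)
  have mg: "(\<lambda>x. indicator {a<..<b} x *\<^sub>R g x) \<in> borel_measurable lebesgue"
    using g(2) unfolding set_integrable_def by (rule borel_measurable_integrable)
  have "set_integrable lebesgue {a<..<b} k"
    using g(2) integrable_cong_AE[OF mg borel_measurable_AE[OF mg ae] ae] by (simp add: set_integrable_def)
  then show "set_integrable lebesgue {a..b} k"
    by (rule absolutely_integrable_spike_set)
      (auto intro: negligible_subset[of "{a, b}"])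
  show "integral {a..t} k = w t * y t - w a * y a" if "t \<in> {a..b}"
    by (rule weak_deriv_integral_closed[OF \<open>a < b\<close> k cont _ that]) fact
qed

section \<open>The Mittag-Leffler kernel\<close>

text \<open>Past \<open>T\<close> each unit step multiplies \<open>Gamma\<close> by at least \<open>T\<close>, that is, by at least as much as it
  multiplies \<open>T powr x\<close>; so the minimum of the quotient over one period bounds it forever.\<close>

lemma Gamma_exponential_lower_bound:
  fixes T :: real
  assumes T: "1 \<le> T"
  shows "\<exists>c>0. \<forall>x\<ge>T. c * T powr x \<le> Gamma x"
proof -
  have "continuous_on {T..T + 1} (\<lambda>x. Gamma x / T powr x)"
    using T by (intro continuous_intros) (auto simp: nonpos_Ints_def)
  then obtain m where m: "m \<in> {T..T + 1}"
    "\<And>x. x \<in> {T..T + 1} \<Longrightarrow> Gamma m / T powr m \<le> Gamma x / T powr x"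
    using continuous_attains_inf[of "{T..T + 1}" "\<lambda>x. Gamma x / T powr x"] by auto
  define c where "c = Gamma m / T powr m"
  have "0 < c" using m(1) T by (auto simp: c_def intro!: divide_pos_pos Gamma_real_pos)
  have bound: "T \<le> x \<longrightarrow> x \<le> T + 1 + real n \<longrightarrow> c * T powr x \<le> Gamma x" for n x
  proof (induction n arbitrary: x)
    case 0
    then show ?case using m(2)[of x] T by (auto simp: c_def field_simps)
  next
    case (Suc n)
    show ?case
    proof (cases "x \<le> T + 1")
      case True
      then show ?thesis using m(2)[of x] T by (auto simp: c_def field_simps)
    next
      case False
      show ?thesis
      proof (intro impI)
        assume "T \<le> x" "x \<le> T + 1 + real (Suc n)"
        then have "c * T powr (x - 1) \<le> Gamma (x - 1)"
          using Suc[of "x - 1"] False by simp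
        then have "T * (c * T powr (x - 1)) \<le> (x - 1) * Gamma (x - 1)"
          using False T \<open>0 < c\<close> by (intro mult_mono) auto
        also have "\<dots> = Gamma x"
          using Gamma_plus1[of "x - 1"] False T by (auto simp: nonpos_Ints_def)
        also have "T * (c * T powr (x - 1)) = c * T powr x"
          using T by (simp add: powr_diff)
        finally show "c * T powr x \<le> Gamma x" .
      qed
    qed
  qed
  have "c * T powr x \<le> Gamma x" if "T \<le> x" for x
  proof -
    obtain n where "x - T - 1 \<le> real n" using real_arch_simple by blast
    then show ?thesis using bound[of x n] that by auto
  qed
  then show ?thesis using \<open>0 < c\<close> by blast
qed

text \<open>The Gamma function outgrows every exponential, so the terms are eventually dominated by a
  geometric series.\<close>

lemma summable_mittag_leffler:
  fixes r \<beta> :: real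
  assumes "0 < \<beta>"
  shows "summable (\<lambda>n. r ^ n / Gamma (\<beta> * real n + 1))"
proof -
  \<comment> \<open>\<open>T\<close> is chosen so that \<open>T powr (\<beta> n)\<close> is \<open>R ^ n\<close>, which beats \<open>\<bar>r\<bar> ^ n\<close> by a factor \<open>2 ^ n\<close>.\<close>
  define R where "R = 2 * \<bar>r\<bar> + 1"
  define T where "T = R powr (1 / \<beta>)"
  have R: "1 \<le> R" "\<bar>r\<bar> / R \<le> 1 / 2" by (auto simp: R_def field_simps)
  have T: "1 \<le> T" using R assms by (auto simp: T_def ge_one_powr_ge_zero)
  have T\<beta>: "T powr \<beta> = R" using R assms by (simp add: T_def powr_powr)
  obtain c where c: "0 < c" "\<And>x. T \<le> x \<Longrightarrow> c * T powr x \<le> Gamma x"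
    using Gamma_exponential_lower_bound[OF T] by blast
  obtain n0 where n0: "T / \<beta> \<le> real n0" using real_arch_simple by blast
  show ?thesis
  proof (rule summable_comparison_test[OF exI[of _ n0]])
    show "summable (\<lambda>n. (1 / c) * (1 / 2) ^ n :: real)"
      by (intro summable_mult summable_geometric) simp
    show "\<forall>n\<ge>n0. norm (r ^ n / Gamma (\<beta> * real n + 1)) \<le> (1 / c) * (1 / 2) ^ n"
    proof (intro allI impI)
      fix n assume "n0 \<le> n"
      then have "T / \<beta> \<le> real n" using n0 by linarith
      then have "T \<le> \<beta> * real n + 1" using assms by (simp add: field_simps)
      then have "c * T powr (\<beta> * real n + 1) \<le> Gamma (\<beta> * real n + 1)" by (rule c)
      moreover have "T powr (\<beta> * real n + 1) = R ^ n * T"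
        using T R by (simp add: powr_add powr_powr[symmetric] T\<beta> powr_realpow)
      moreover have "c * R ^ n \<le> c * (R ^ n * T)"
        using c T R by simp
      ultimately have G: "c * R ^ n \<le> Gamma (\<beta> * real n + 1)" by simp
      have pos: "0 < c * R ^ n" using c R by simp
      have "norm (r ^ n / Gamma (\<beta> * real n + 1)) = \<bar>r\<bar> ^ n / Gamma (\<beta> * real n + 1)"
        using pos G by (simp add: power_abs)
      also have "\<dots> \<le> \<bar>r\<bar> ^ n / (c * R ^ n)"
        using G by (rule divide_left_mono) (use pos G in \<open>auto intro!: mult_pos_pos[OF less_le_trans[OF pos G] pos]\<close>)
      also have "\<dots> = (1 / c) * (\<bar>r\<bar> / R) ^ n"
        by (simp add: power_divide)
      also have "\<dots> \<le> (1 / c) * (1 / 2) ^ n"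
        using c R by (intro mult_left_mono power_mono) auto
      finally show "norm (r ^ n / Gamma (\<beta> * real n + 1)) \<le> (1 / c) * (1 / 2) ^ n" .
    qed
  qed
qed

text \<open>The terms with positive and those with negative coefficients are collected separately; each
  group is nondecreasing on the positive half-line.\<close>

lemma power_series_eq_diff_mono:
  fixes a :: "nat \<Rightarrow> real"
  assumes a: "\<And>x. summable (\<lambda>n. a n * x ^ n)"
  obtains A B where "mono_on {0..} A" "mono_on {0..} B"
    "continuous_on UNIV A" "continuous_on UNIV B"
    "\<And>x. (\<Sum>n. a n * x ^ n) = A x - B x"
proof
  have abs: "summable (\<lambda>n. \<bar>a n\<bar> * \<bar>x\<bar> ^ n)" for x
    using powser_insidea[OF a[of "\<bar>x\<bar> + 1"], of x] by (simp add: abs_mult power_abs)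
  have sum: "summable (\<lambda>n. max 0 (s * a n) * x ^ n)" if "\<bar>s\<bar> \<le> 1" for s x
  proof (rule summable_comparison_test[OF _ abs[of x]], intro exI allI impI)
    fix n
    have "\<bar>max 0 (s * a n)\<bar> \<le> \<bar>s\<bar> * \<bar>a n\<bar>" by (simp add: max_def flip: abs_mult)
    also have "\<dots> \<le> 1 * \<bar>a n\<bar>" using that by (intro mult_right_mono) auto
    finally show "norm (max 0 (s * a n) * x ^ n) \<le> \<bar>a n\<bar> * \<bar>x\<bar> ^ n"
      by (simp add: abs_mult power_abs mult_right_mono)
  qed
  have mono: "mono_on {0..} (\<lambda>x. \<Sum>n. max 0 (s * a n) * x ^ n)" if "\<bar>s\<bar> \<le> 1" for s
    by (intro mono_onI suminf_le sum that mult_left_mono power_mono) auto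
  have cont: "continuous_on UNIV (\<lambda>x. \<Sum>n. max 0 (s * a n) * x ^ n)" if "\<bar>s\<bar> \<le> 1" for s
    by (intro continuous_at_imp_continuous_on ballI isCont_powser_converges_everywhere sum that)
  show "mono_on {0..} (\<lambda>x. \<Sum>n. max 0 (1 * a n) * x ^ n)"
    "mono_on {0..} (\<lambda>x. \<Sum>n. max 0 (- 1 * a n) * x ^ n)" by (intro mono; simp)+
  show "continuous_on UNIV (\<lambda>x. \<Sum>n. max 0 (1 * a n) * x ^ n)"
    "continuous_on UNIV (\<lambda>x. \<Sum>n. max 0 (- 1 * a n) * x ^ n)" by (intro cont; simp)+
  fix x
  have "(\<Sum>n. max 0 (1 * a n) * x ^ n) - (\<Sum>n. max 0 (- 1 * a n) * x ^ n)
      = (\<Sum>n. max 0 (1 * a n) * x ^ n - max 0 (- 1 * a n) * x ^ n)"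
    by (rule suminf_diff) (intro sum; simp)+
  also have "\<dots> = (\<Sum>n. a n * x ^ n)"
    by (intro suminf_cong) (simp add: max_def)
  finally show "(\<Sum>n. a n * x ^ n)
    = (\<Sum>n. max 0 (1 * a n) * x ^ n) - (\<Sum>n. max 0 (- 1 * a n) * x ^ n)" ..
qed

text \<open>The coefficients may alternate in sign (this depends on the sign of \<open>ln p\<close>), so the kernel
  need not be monotone. Its two monotone parts are all that the second mean value theorem needs,
  and \<open>A 0 - B 0\<close> is the leading coefficient of the series.\<close>

lemma mittag_leffler_kernel:
  fixes \<beta> \<mu> p :: real
  assumes \<beta>: "0 < \<beta>"
  obtains A B where "mono_on {0..} A" "mono_on {0..} B"
    "continuous_on {0..} A" "continuous_on {0..} B" "A 0 - B 0 = 1"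
    "\<And>r. 0 \<le> r \<Longrightarrow> power_mittag_leffler p \<beta> 1 (- \<mu> * r powr \<beta>) = A r - B r"
proof -
  define a where "a n = (- \<mu> * ln p) ^ n / Gamma (\<beta> * real n + 1)" for n
  have eq: "a n * x ^ n = (- \<mu> * x * ln p) ^ n / Gamma (\<beta> * real n + 1)" for n x
    by (simp add: a_def power_mult_distrib[symmetric] mult_ac)
  have "summable (\<lambda>n. a n * x ^ n)" for x
    unfolding eq using \<beta> by (rule summable_mittag_leffler)
  then obtain A B where AB: "mono_on {0..} A" "mono_on {0..} B"
    "continuous_on UNIV A" "continuous_on UNIV B"
    and sum: "\<And>x. (\<Sum>n. a n * x ^ n) = A x - B x"
    using power_series_eq_diff_mono[of a] by blast
  have pow: "mono_on {0..} (\<lambda>r. r powr \<beta>)" "continuous_on {0..} (\<lambda>r. r powr \<beta>)"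
    using \<beta> by (auto intro!: mono_onI powr_mono2 continuous_on_powr' continuous_on_id continuous_on_const)
  show ?thesis
  proof
    show "mono_on {0..} (\<lambda>r. A (r powr \<beta>))" "mono_on {0..} (\<lambda>r. B (r powr \<beta>))"
      using AB(1,2) pow(1) by (auto simp: monotone_on_def)
    show "continuous_on {0..} (\<lambda>r. A (r powr \<beta>))" "continuous_on {0..} (\<lambda>r. B (r powr \<beta>))"
      using AB(3,4) pow(2) by (auto intro: continuous_on_compose2)
    have "A 0 - B 0 = a 0" unfolding sum[symmetric] by (rule powser_zero)
    then show "A (0 powr \<beta>) - B (0 powr \<beta>) = 1" using \<beta> by (simp add: a_def)
    show "power_mittag_leffler p \<beta> 1 (- \<mu> * r powr \<beta>) = A (r powr \<beta>) - B (r powr \<beta>)" for r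
      unfolding sum[symmetric] power_mittag_leffler_def eq by simp
  qed
qed

section \<open>Volterra inequalities with a kernel of bounded variation\<close>

text \<open>The second mean value theorem takes the place of an integration by parts: it expresses the
  convolution through values of the primitive of \<open>h\<close> alone. The first term carries the kernel at 0;
  for \<open>A\<close> continuous at 0, the factor of the second term is small when \<open>t\<close> is close to \<open>t0\<close>.\<close>

lemma mono_kernel_integral:
  fixes h A :: "real \<Rightarrow> real"
  assumes h: "h integrable_on {a..b}" and A: "mono_on {0..} A"
    and t: "a \<le> t0" "t0 \<le> t" "t \<le> b"
    and 0: "\<And>s. s \<in> {a..t0} \<Longrightarrow> integral {a..s} h = 0"
  obtains c where "c \<in> {t0..t}"
    and "((\<lambda>s. A (t - s) * h s) has_integral
      A 0 * integral {a..t} h + (A (t - t0) - A 0) * integral {a..c} h) {a..t}"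
proof -
  have hI: "h integrable_on {r..s}" if "a \<le> r" "s \<le> b" for r s
    using integrable_on_subinterval[OF h] that by auto
  have diff: "integral {r..s} h = integral {a..s} h - integral {a..r} h" if "a \<le> r" "r \<le> s" "s \<le> b" for r s
    using Henstock_Kurzweil_Integration.integral_combine[of a r s h] hI[of a s] that by simp
  \<comment> \<open>The mean value theorem asks for a nondecreasing factor, and \<open>\<lambda>s. A (t - s)\<close> is nonincreasing.\<close>
  have mono: "- A (t - r) \<le> - A (t - s)" if "r \<le> s" "s \<le> t" for r s
    using monotone_onD[OF A, of "t - s" "t - r"] that by auto
  obtain c1 where c1: "c1 \<in> {a..t0}" and I1: "((\<lambda>s. - A (t - s) * h s) has_integral
      - A (t - a) * integral {a..c1} h + - A (t - t0) * integral {c1..t0} h) {a..t0}"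
    by (rule second_mean_value_theorem_full[OF hI[of a t0], where g="\<lambda>s. - A (t - s)"])
      (use t mono in auto)
  obtain c where c: "c \<in> {t0..t}" and I2: "((\<lambda>s. - A (t - s) * h s) has_integral
      - A (t - t0) * integral {t0..c} h + - A (t - t) * integral {c..t} h) {t0..t}"
    by (rule second_mean_value_theorem_full[OF hI[of t0 t], where g="\<lambda>s. - A (t - s)"])
      (use t mono in auto)
  have "integral {a..c1} h = 0" "integral {c1..t0} h = 0" "integral {t0..c} h = integral {a..c} h"
    "integral {c..t} h = integral {a..t} h - integral {a..c} h"
    using 0[of c1] 0[of t0] diff[of c1 t0] diff[of t0 c] diff[of c t] c1 c t by auto
  with has_integral_combine[OF t(1,2) I1 I2]
  have "((\<lambda>s. - A (t - s) * h s) has_integral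
      - (A 0 * integral {a..t} h + (A (t - t0) - A 0) * integral {a..c} h)) {a..t}"
    by (simp add: algebra_simps)
  from has_integral_neg[OF this] have "((\<lambda>s. A (t - s) * h s) has_integral
      A 0 * integral {a..t} h + (A (t - t0) - A 0) * integral {a..c} h) {a..t}"
    by (simp add: algebra_simps)
  with c show ?thesis by (rule that)
qed

text \<open>If the primitive \<open>d\<close> of \<open>h\<close> vanishes up to \<open>t0\<close>, the convolution at \<open>m\<close> is \<open>d m\<close> up to an error of
  at most \<open>2 * e\<close> times the maximum of \<open>\<bar>d\<bar>\<close> between \<open>t0\<close> and \<open>t0 + \<delta>\<close>. At a point \<open>m\<close> where this maximum
  is attained, the hypothesis bounds it by \<open>q + 2 * e < 1\<close> times itself, so it is 0. As \<open>\<delta>\<close> depends on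
  the kernel and \<open>q\<close> only, finitely many such steps exhaust the interval.\<close>

lemma volterra_unique:
  fixes h A B :: "real \<Rightarrow> real"
  assumes h: "h integrable_on {a..b}"
    and A: "mono_on {0..} A" "continuous_on {0..} A"
    and B: "mono_on {0..} B" "continuous_on {0..} B"
    and AB: "A 0 - B 0 = 1" and "q < 1"
    and bound: "\<And>t. t \<in> {a..b} \<Longrightarrow>
      \<bar>integral {a..t} (\<lambda>s. (A (t - s) - B (t - s)) * h s)\<bar> \<le> q * \<bar>integral {a..t} h\<bar>"
    and t: "t \<in> {a..b}"
  shows "integral {a..t} h = 0"
proof -
  define d where "d s = integral {a..s} h" for s
  have cd: "continuous_on {a..b} d"
    unfolding d_def[abs_def] using h by (rule indefinite_integral_continuous_1)
  \<comment> \<open>Two error terms of size \<open>e\<close>, one for each monotone part, use up half of the margin \<open>1 - q\<close>.\<close>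
  define e where "e = (1 - q) / 4"
  have e: "0 < e" using \<open>q < 1\<close> by (simp add: e_def)
  obtain \<delta>1 where \<delta>1: "0 < \<delta>1" "\<And>r. 0 \<le> r \<Longrightarrow> r < \<delta>1 \<Longrightarrow> \<bar>A r - A 0\<bar> < e"
    using A(2)[unfolded continuous_on_iff, rule_format, of 0 e] e by (auto simp: dist_real_def)
  obtain \<delta>2 where \<delta>2: "0 < \<delta>2" "\<And>r. 0 \<le> r \<Longrightarrow> r < \<delta>2 \<Longrightarrow> \<bar>B r - B 0\<bar> < e"
    using B(2)[unfolded continuous_on_iff, rule_format, of 0 e] e by (auto simp: dist_real_def)
  define \<delta> where "\<delta> = min \<delta>1 \<delta>2 / 2"
  have \<delta>: "0 < \<delta>" "\<delta> < \<delta>1" "\<delta> < \<delta>2" using \<delta>1(1) \<delta>2(1) by (auto simp: \<delta>_def)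
  have advance: "d s = 0"
    if t0: "a \<le> t0" "t0 \<le> b" "\<And>s. s \<in> {a..t0} \<Longrightarrow> d s = 0" and s: "s \<in> {t0..b}" "s \<le> t0 + \<delta>" for t0 s
  proof -
    define t1 where "t1 = min b (t0 + \<delta>)"
    have t1: "t0 \<le> t1" "t1 \<le> b" "t1 \<le> t0 + \<delta>" using t0 \<delta> by (auto simp: t1_def)
    have "continuous_on {t0..t1} (\<lambda>s. \<bar>d s\<bar>)"
      by (intro continuous_intros continuous_on_subset[OF cd]) (use t0 t1 in auto)
    then obtain m where m: "m \<in> {t0..t1}" and max: "\<And>s. s \<in> {t0..t1} \<Longrightarrow> \<bar>d s\<bar> \<le> \<bar>d m\<bar>"
      using continuous_attains_sup[of "{t0..t1}" "\<lambda>s. \<bar>d s\<bar>"] t1(1) by auto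
    have mb: "a \<le> t0" "t0 \<le> m" "m \<le> b" using m t0 t1 by auto
    have zero: "\<And>s. s \<in> {a..t0} \<Longrightarrow> integral {a..s} h = 0"
      using t0(3) by (simp add: d_def)
    obtain c where c: "c \<in> {t0..m}" and IA: "((\<lambda>s. A (m - s) * h s) has_integral
        A 0 * d m + (A (m - t0) - A 0) * d c) {a..m}"
      using mono_kernel_integral[OF h A(1) mb zero] unfolding d_def by blast
    obtain c' where c': "c' \<in> {t0..m}" and IB: "((\<lambda>s. B (m - s) * h s) has_integral
        B 0 * d m + (B (m - t0) - B 0) * d c') {a..m}"
      using mono_kernel_integral[OF h B(1) mb zero] unfolding d_def by blast
    define x where "x = (A (m - t0) - A 0) * d c"
    define y where "y = (B (m - t0) - B 0) * d c'"
    have "integral {a..m} (\<lambda>s. (A (m - s) - B (m - s)) * h s) = (A 0 - B 0) * d m + x - y"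
      using integral_unique[OF has_integral_diff[OF IA IB]]
      by (simp add: left_diff_distrib x_def y_def)
    then have "\<bar>d m + x - y\<bar> \<le> q * \<bar>d m\<bar>"
      using bound[of m] mb AB by (simp add: d_def)
    moreover have "\<bar>x\<bar> \<le> e * \<bar>d m\<bar>" "\<bar>y\<bar> \<le> e * \<bar>d m\<bar>"
      unfolding x_def y_def abs_mult
      using \<delta>1(2)[of "m - t0"] \<delta>2(2)[of "m - t0"] m t1 \<delta> max c c'
      by (auto intro!: mult_mono simp: less_imp_le)
    ultimately have "\<bar>d m\<bar> \<le> q * \<bar>d m\<bar> + 2 * (e * \<bar>d m\<bar>)" by linarith
    then have "2 * (e * \<bar>d m\<bar>) \<le> 0" by (simp add: e_def field_simps)
    then have "d m = 0" using e by (simp add: mult_le_0_iff)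
    then show ?thesis using max[of s] s by (auto simp: t1_def)
  qed
  have "\<forall>s\<in>{a..b}. s \<le> a + real n * \<delta> \<longrightarrow> d s = 0" for n
  proof (induction n)
    case 0
    then show ?case by (auto simp: d_def)
  next
    case (Suc n)
    show ?case
    proof (intro ballI impI)
      fix s assume s: "s \<in> {a..b}" "s \<le> a + real (Suc n) * \<delta>"
      show "d s = 0"
      proof (cases "s \<le> a + real n * \<delta>")
        case True
        then show ?thesis using Suc s by blast
      next
        case False
        show ?thesis
          by (rule advance[of "a + real n * \<delta>" s]) (use Suc s False \<delta>(1) in \<open>auto simp: algebra_simps\<close>)
      qed
    qed
  qed
  moreover obtain n where "(t - a) / \<delta> \<le> real n" using real_arch_simple by blast
  ultimately show ?thesis using t \<delta>(1) unfolding d_def by (auto simp: field_simps)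
qed

section \<open>Uniqueness for the initial value problem\<close>

theorem theorem3:
  fixes N :: "real \<Rightarrow> real" and \<omega> :: "real \<Rightarrow> real" and f :: "real \<Rightarrow> real \<Rightarrow> real"
    and y z :: "real \<Rightarrow> real" and a b \<alpha> \<beta> p y0 L :: real
  assumes N_pos: "\<And>x. 0 \<le> x \<Longrightarrow> x < 1 \<Longrightarrow> N x > 0"
    and N_zero: "N 0 = 1"
    and N_lim: "(N \<longlongrightarrow> 1) (at_left 1)"
    and ab: "a < b"
    and alpha: "0 \<le> \<alpha>" "\<alpha> < 1"
    and beta: "\<beta> > 0"
    and p: "p > 0"
    and w_C1: "C1_closed_interval a b \<omega>"
    and w_pos: "\<And>t. t \<in> {a..b} \<Longrightarrow> \<omega> t > 0"
    and f_cont: "continuous_on ({a..b} \<times> UNIV) (\<lambda>(t, x). f t x)"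
    and f_init: "f a y0 = 0"
    and sol_y: "power_ivp_solution N a b \<omega> \<alpha> \<beta> p f y0 y"
    and sol_z: "power_ivp_solution N a b \<omega> \<alpha> \<beta> p f y0 z"
    and L_pos: "L > 0"
    and lipschitz: "\<And>t u v. t \<in> {a..b} \<Longrightarrow> \<bar>f t u - f t v\<bar> \<le> L * \<bar>u - v\<bar>"
    and L_small: "L < 1 / power_phi N \<alpha>"
  shows "\<forall>t\<in>{a..b}. y t = z t"
proof -
  have \<phi>: "0 < power_phi N \<alpha>"
    using N_pos[OF alpha] alpha by (simp add: power_phi_def)
  have q: "power_phi N \<alpha> * L < 1"
    using L_small \<phi> by (simp add: field_simps)
  obtain A B where A: "mono_on {0..} A" "continuous_on {0..} A"
    and B: "mono_on {0..} B" "continuous_on {0..} B" and AB: "A 0 - B 0 = 1"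
    and kernel: "\<And>r. 0 \<le> r \<Longrightarrow>
      power_mittag_leffler p \<beta> 1 (- power_mu \<alpha> * r powr \<beta>) = A r - B r"
    using mittag_leffler_kernel[OF beta, of p "power_mu \<alpha>"] by metis
  define k where "k u = weak_deriv a b (\<lambda>r. \<omega> r * u r)" for u
  have sol: "set_integrable lebesgue {a..b} (k u)"
    "\<And>t. t \<in> {a..b} \<Longrightarrow> integral {a..t} (k u) = \<omega> t * u t - \<omega> a * y0"
    "\<And>t. t \<in> {a..b} \<Longrightarrow> set_integrable lebesgue {a..t} (\<lambda>s. (A (t - s) - B (t - s)) * k u s)"
    "\<And>t. t \<in> {a..b} \<Longrightarrow> integral {a..t} (\<lambda>s. (A (t - s) - B (t - s)) * k u s)
      = power_phi N \<alpha> * \<omega> t * f t (u t)"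
    if u: "power_ivp_solution N a b \<omega> \<alpha> \<beta> p f y0 u" for u
  proof -
    have H1: "u \<in> sobolev_H1 a b" and cu: "continuous_on {a..b} u" and ua: "u a = y0"
      and eq: "\<And>t. t \<in> {a..b} \<Longrightarrow> power_caputo_deriv N a b \<omega> \<alpha> \<beta> p u t = f t (u t)"
      using u by (auto simp: power_ivp_solution_def)
    show ku: "set_integrable lebesgue {a..b} (k u)"
      unfolding k_def by (rule weak_deriv_weighted(1)[OF ab w_C1 H1 cu])
    fix t assume t: "t \<in> {a..b}"
    show "integral {a..t} (k u) = \<omega> t * u t - \<omega> a * y0"
      unfolding k_def using weak_deriv_weighted(2)[OF ab w_C1 H1 cu t] ua by simp
    have "continuous_on {a..t} (\<lambda>s. A (t - s) - B (t - s))"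
      by (intro continuous_intros continuous_on_compose2[OF A(2)] continuous_on_compose2[OF B(2)]) auto
    then show int: "set_integrable lebesgue {a..t} (\<lambda>s. (A (t - s) - B (t - s)) * k u s)"
      by (rule set_integrable_continuous_mult)
        (use t in \<open>auto intro: set_integrable_subset[OF ku]\<close>)
    have "(LINT s:{a..t}|lebesgue.
        power_mittag_leffler p \<beta> 1 (- power_mu \<alpha> * (t - s) powr \<beta>) * k u s)
      = (LINT s:{a..t}|lebesgue. (A (t - s) - B (t - s)) * k u s)"
    proof (rule set_lebesgue_integral_cong, simp, intro allI impI)
      fix s assume "s \<in> {a..t}"
      then show "power_mittag_leffler p \<beta> 1 (- power_mu \<alpha> * (t - s) powr \<beta>) * k u s
          = (A (t - s) - B (t - s)) * k u s"
        using kernel[of "t - s"] by simp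
    qed
    also have "\<dots> = integral {a..t} (\<lambda>s. (A (t - s) - B (t - s)) * k u s)"
      using int by (rule set_lebesgue_integral_eq_integral)
    finally show "integral {a..t} (\<lambda>s. (A (t - s) - B (t - s)) * k u s)
        = power_phi N \<alpha> * \<omega> t * f t (u t)"
      using eq[OF t] \<phi> w_pos[OF t] by (simp add: power_caputo_deriv_def k_def field_simps)
  qed
  \<comment> \<open>The weak derivative of \<open>\<omega> (y - z)\<close>; for it the two equations become a Volterra inequality
    with constant \<open>power_phi N \<alpha> * L\<close>.\<close>
  define h where "h s = k y s - k z s" for s
  note hk = set_lebesgue_integral_eq_integral(1)
  have h: "h integrable_on {a..b}"
    unfolding h_def by (intro integrable_diff hk sol(1) sol_y sol_z)
  have d: "integral {a..t} h = \<omega> t * (y t - z t)" if t: "t \<in> {a..b}" for t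
  proof -
    have k_int: "k u integrable_on {a..t}" if "power_ivp_solution N a b \<omega> \<alpha> \<beta> p f y0 u" for u
      by (rule integrable_on_subinterval[OF hk[OF sol(1)[OF that]]]) (use t in auto)
    then have "integral {a..t} h = integral {a..t} (k y) - integral {a..t} (k z)"
      unfolding h_def by (intro integral_diff k_int sol_y sol_z)
    then show ?thesis
      using sol(2)[OF sol_y t] sol(2)[OF sol_z t] by (simp add: algebra_simps)
  qed
  have bound: "\<bar>integral {a..t} (\<lambda>s. (A (t - s) - B (t - s)) * h s)\<bar>
      \<le> power_phi N \<alpha> * L * \<bar>integral {a..t} h\<bar>" if t: "t \<in> {a..b}" for t
  proof -
    have "integral {a..t} (\<lambda>s. (A (t - s) - B (t - s)) * h s)
      = integral {a..t} (\<lambda>s. (A (t - s) - B (t - s)) * k y s)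
        - integral {a..t} (\<lambda>s. (A (t - s) - B (t - s)) * k z s)"
      unfolding h_def right_diff_distrib
      by (intro integral_diff hk[OF sol(3)] sol_y sol_z t)
    also have "\<dots> = power_phi N \<alpha> * \<omega> t * (f t (y t) - f t (z t))"
      using sol(4)[OF sol_y t] sol(4)[OF sol_z t] by (simp add: algebra_simps)
    finally have "\<bar>integral {a..t} (\<lambda>s. (A (t - s) - B (t - s)) * h s)\<bar>
        = power_phi N \<alpha> * \<omega> t * \<bar>f t (y t) - f t (z t)\<bar>"
      using \<phi> w_pos[OF t] by (simp add: abs_mult)
    also have "\<dots> \<le> power_phi N \<alpha> * \<omega> t * (L * \<bar>y t - z t\<bar>)"
      using \<phi> w_pos[OF t] lipschitz[OF t] by (intro mult_left_mono) auto
    also have "\<dots> = power_phi N \<alpha> * L * \<bar>integral {a..t} h\<bar>"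
      using w_pos[OF t] by (simp add: d[OF t] abs_mult)
    finally show ?thesis .
  qed
  show ?thesis
  proof
    fix t assume t: "t \<in> {a..b}"
    have "integral {a..t} h = 0"
      by (rule volterra_unique[OF h A B AB q bound t])
    then show "y t = z t" using d[OF t] w_pos[OF t] by simp
  qed
qed

end
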